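(* Let $d\ge 1$ and $K>d$ be integers. Given a nonzero $\alpha\in\mathbb{Z}_2^K$, there exists a Parseval frame $\mathcal{F}=\{f_i\}_{i=1}^K$ for $\mathbb{Z}_2^d$ with $(f_i,f_i)=\alpha[i]$ for every $1\le i\le K$ if and only if $\|\alpha\|_0\equiv d\pmod 2$.
   Context: $\mathbb{Z}_2$ is the field with two elements. The dot product on $\mathbb{Z}_2^d$ is $(a,b)=\sum_{n=1}^d a[n]b[n]\in\mathbb{Z}_2$. A Parseval frame for $\mathbb{Z}_2^d$ is a finite sequence $\{f_j\}_{j=1}^K$ in $\mathbb{Z}_2^d$ (repetitions and zero vectors allowed) with $y=\sum_{j=1}^K (y,f_j)f_j$ for all $y\in\mathbb{Z}_2^d$. For a binary vector $\alpha$, $\|\alpha\|_0$ is the number of nonzero entries of $\alpha$. *)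

theory Defs
  imports
    "Jordan_Normal_Form.Matrix"
    "HOL-Library.Z2"
    "HOL-Number_Theory.Cong"
begin

text \<open>
  The field \<open>\<int>\<^sub>2\<close> is the type \<^typ>\<open>bit\<close>, the space \<open>\<int>\<^sub>2\<^sup>d\<close> is
  \<open>carrier_vec d :: bit vec set\<close>, and the dot product is \<^const>\<open>scalar_prod\<close>, written
  \<open>\<bullet>\<close>. Indices run from \<open>0\<close>: a sequence \<open>f\<^sub>1, \<dots>, f\<^sub>K\<close> is the restriction of
  \<open>f :: nat \<Rightarrow> bit vec\<close> to \<open>{..<K}\<close>; values of \<open>f\<close> outside that set are irrelevant.
\<close>

definition parseval_frame :: "nat \<Rightarrow> nat \<Rightarrow> (nat \<Rightarrow> bit vec) \<Rightarrow> bool" where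
  "parseval_frame d K f \<longleftrightarrow>
     (\<forall>j<K. f j \<in> carrier_vec d) \<and>
     (\<forall>y\<in>carrier_vec d. y = finsum_vec TYPE(bit) d (\<lambda>j. (y \<bullet> f j) \<cdot>\<^sub>v f j) {..<K})"

definition norm0 :: "bit vec \<Rightarrow> nat" where
  "norm0 \<alpha> = card {i. i < dim_vec \<alpha> \<and> \<alpha> $ i \<noteq> 0}"

end

theory Submission
  imports Defs
begin

text \<open>
  Read a frame for \<open>\<int>\<^sub>2\<^sup>d\<close> with \<open>K\<close> members as the columns of a \<open>d \<times> K\<close> matrix \<open>F\<close>. The
  reconstruction formula says \<open>F F\<^sup>T = I\<close>: the \<open>d\<close> rows are orthonormal in \<open>\<int>\<^sub>2\<^sup>K\<close>
  (\<open>parseval_frame_iff_orthonormal_rows\<close>). The prescribed values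
  \<open>\<alpha>[i] = (f\<^sub>i, f\<^sub>i)\<close> are the diagonal of \<open>F\<^sup>T F\<close>, so that
  \<open>\<parallel>\<alpha>\<parallel>\<^sub>0 = tr (F\<^sup>T F) = tr (F F\<^sup>T) = d\<close> in \<open>\<int>\<^sub>2\<close>, which is the necessity.

  For the sufficiency, note that \<open>x\<^sup>2 = x\<close> in \<open>\<int>\<^sub>2\<close>, so \<open>(f\<^sub>i, f\<^sub>i)\<close> is the sum of the
  entries of the \<open>i\<close>-th column. Thus \<open>\<alpha>\<close> has to be written as the sum of \<open>d\<close> orthonormal
  vectors of \<open>\<int>\<^sub>2\<^sup>K\<close>. Identify vectors with their supports: an inner product is then the parity of
  the size of an intersection, and a sum is a symmetric difference. Let \<open>S\<close> be the support of \<open>\<alpha>\<close>.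
  If both \<open>d\<close> and \<open>|S|\<close> exceed 1, use the singleton of some point of \<open>S\<close> as one row and delete
  that point; this preserves the parity condition and \<open>K > d\<close>. It remains to treat \<open>d = 1\<close>, where
  the single row \<open>S\<close> has odd size, and \<open>S = {x}\<close> with \<open>d\<close> odd. In the latter case choose a set \<open>M\<close>
  of \<open>d\<close> points other than \<open>x\<close>, which is possible because \<open>K > d\<close>, and take as rows the \<open>d\<close> sets
  obtained from \<open>{x} \<union> M\<close> by omitting one point of \<open>M\<close>. The combinatorial statement is
  \<open>orthonormal_sets_with_given_sum\<close>.
\<close>

lemma of_nat_bit_eq_parity: "(of_nat n :: bit) = of_bool (odd n)"
  by (induction n) auto

lemma sum_of_bool_bit:
  assumes "finite A"
  shows "(\<Sum>x\<in>A. of_bool (P x) :: bit) = of_bool (odd (card {x \<in> A. P x}))"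
  using assms by (simp add: sum_of_bool_eq of_nat_bit_eq_parity Int_def)

text \<open>
  The \<open>n\<close>-th coordinate of the reconstruction of \<open>y\<close> is the inner product of \<open>y\<close> with the \<open>n\<close>-th
  column of the matrix \<open>F F\<^sup>T\<close>; evaluating at the unit vectors recovers this matrix.
\<close>

lemma parseval_frame_iff_orthonormal_rows:
  "parseval_frame d K f \<longleftrightarrow>
     (\<forall>k<K. f k \<in> carrier_vec d) \<and>
     (\<forall>m<d. \<forall>n<d. (\<Sum>k<K. f k $ m * f k $ n) = of_bool (m = n))"
proof (cases "\<forall>k<K. f k \<in> carrier_vec d")
  case True
  let ?R = "\<lambda>y. finsum_vec TYPE(bit) d (\<lambda>k. (y \<bullet> f k) \<cdot>\<^sub>v f k) {..<K}"
  have coord: "?R y $ n = (\<Sum>m<d. y $ m * (\<Sum>k<K. f k $ m * f k $ n))"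
    if "n < d" for y n
  proof -
    have "?R y $ n = (\<Sum>k<K. ((y \<bullet> f k) \<cdot>\<^sub>v f k) $ n)"
      using True that by (intro index_finsum_vec) auto
    also have "\<dots> = (\<Sum>k<K. (\<Sum>m<d. y $ m * f k $ m) * f k $ n)"
      using True that
      by (intro sum.cong) (auto simp: scalar_prod_def lessThan_atLeast0 simp del: mult_bit_eq_and)
    also have "\<dots> = (\<Sum>m<d. y $ m * (\<Sum>k<K. f k $ m * f k $ n))"
      by (simp add: sum_distrib_left sum_distrib_right mult.assoc sum.swap[of _ "{..<d}"]
          del: mult_bit_eq_and)
    finally show ?thesis .
  qed
  have dim: "?R y \<in> carrier_vec d" for y
    using True by (intro finsum_vec_closed) auto
  show ?thesis
  proof
    assume P: "parseval_frame d K f"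
    have "(\<Sum>k<K. f k $ m * f k $ n) = of_bool (m = n)" if "m < d" "n < d" for m n
    proof -
      have "(of_bool (m = n) :: bit) = unit_vec d m $ n"
        using that by auto
      also have "unit_vec d m = ?R (unit_vec d m)"
        using P unfolding parseval_frame_def by auto
      also have "\<dots> $ n = (\<Sum>l<d. unit_vec d m $ l * (\<Sum>k<K. f k $ l * f k $ n))"
        using that by (intro coord)
      also have "\<dots> = (\<Sum>l<d. if l = m then \<Sum>k<K. f k $ l * f k $ n else 0)"
        using that by (intro sum.cong) (auto simp del: mult_bit_eq_and simp: index_unit_vec)
      finally show ?thesis
        using that by (simp del: mult_bit_eq_and)
    qed
    with True show "(\<forall>k<K. f k \<in> carrier_vec d) \<and>
      (\<forall>m<d. \<forall>n<d. (\<Sum>k<K. f k $ m * f k $ n) = of_bool (m = n))" by blast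
  next
    assume orth: "(\<forall>k<K. f k \<in> carrier_vec d) \<and>
      (\<forall>m<d. \<forall>n<d. (\<Sum>k<K. f k $ m * f k $ n) = of_bool (m = n))"
    have "y = ?R y" if y: "y \<in> carrier_vec d" for y
    proof (rule eq_vecI)
      fix n assume "n < dim_vec (?R y)"
      then have n: "n < d" using carrier_vecD[OF dim[of y]] by simp
      have "?R y $ n = (\<Sum>m<d. if m = n then y $ m else 0)"
        unfolding coord[OF n] using orth n
        by (intro sum.cong) (auto simp del: mult_bit_eq_and)
      with n show "y $ n = ?R y $ n" by simp
    qed (use y carrier_vecD[OF dim[of y]] in simp)
    with True show "parseval_frame d K f"
      unfolding parseval_frame_def by blast
  qed
qed (auto simp: parseval_frame_def)

text \<open>
  Over \<open>\<int>\<^sub>2\<close> this is the equality of the traces of \<open>F\<^sup>T F\<close> and \<open>F F\<^sup>T\<close>.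
\<close>

lemma parseval_frame_norms_sum:
  assumes "parseval_frame d K f"
  shows "(\<Sum>k<K. f k \<bullet> f k) = of_nat d"
proof -
  have f: "\<forall>k<K. f k \<in> carrier_vec d"
    and orth: "\<forall>m<d. \<forall>n<d. (\<Sum>k<K. f k $ m * f k $ n) = of_bool (m = n)"
    using assms unfolding parseval_frame_iff_orthonormal_rows by blast+
  have "(\<Sum>k<K. f k \<bullet> f k) = (\<Sum>k<K. \<Sum>n<d. f k $ n * f k $ n)"
    using f by (intro sum.cong) (auto simp: scalar_prod_def lessThan_atLeast0 simp del: mult_bit_eq_and)
  also have "\<dots> = (\<Sum>n<d. \<Sum>k<K. f k $ n * f k $ n)"
    by (rule sum.swap)
  also have "\<dots> = (\<Sum>n<d. 1)"
    using orth by (intro sum.cong) (auto simp del: mult_bit_eq_and)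
  finally show ?thesis by simp
qed

text \<open>
  Omitting two different points from a set of even size \<open>d + 1\<close> leaves an even number of points,
  omitting one leaves an odd number; this gives the orthonormality. A point of \<open>M\<close> lies in all
  but one of the rows, and \<open>x\<close> lies in all \<open>d\<close> of them, whence the sum.
\<close>

lemma orthonormal_sets_with_sum_singleton:
  fixes I :: "'a set"
  assumes "finite I" "x \<in> I" "odd d" "d < card I"
  shows "\<exists>R. (\<forall>m<d. R m \<subseteq> I) \<and>
    (\<forall>m<d. \<forall>n<d. odd (card (R m \<inter> R n)) \<longleftrightarrow> m = n) \<and>
    (\<forall>k\<in>I. odd (card {m. m < d \<and> k \<in> R m}) \<longleftrightarrow> k = x)"
proof -
  have "d \<le> card (I - {x})" using assms by simp
  then obtain M where M: "M \<subseteq> I - {x}" "card M = d" "finite M"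
    by (rule obtain_subset_with_card_n)
  then obtain h where h: "bij_betw h {..<d} M"
    using ex_bij_betw_nat_finite[of M] by (auto simp: lessThan_atLeast0)
  have hM: "h m \<in> M" if "m < d" for m
    using h that by (auto simp: bij_betw_def)
  have hinj: "h m = h n \<longleftrightarrow> m = n" if "m < d" "n < d" for m n
    using h that by (auto simp: bij_betw_def inj_on_def)
  define R where "R = (\<lambda>m. insert x M - {h m})"
  have "R m \<subseteq> I" for m
    using M assms by (auto simp: R_def)
  moreover have "odd (card (R m \<inter> R n)) \<longleftrightarrow> m = n" if mn: "m < d" "n < d" for m n
  proof -
    have "R m \<inter> R n = insert x M - {h m, h n}"
      by (auto simp: R_def)
    moreover have "card (insert x M - {h m, h n}) = Suc d - card {h m, h n}"
      using M hM[OF mn(1)] hM[OF mn(2)] by (subst card_Diff_subset) (auto simp: card_insert_if)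
    moreover have "card {h m, h n} = (if m = n then 1 else 2)"
      using hinj[OF mn] by auto
    moreover have "d \<ge> 2" if "m \<noteq> n"
      using mn that by linarith
    ultimately show ?thesis using \<open>odd d\<close> by auto
  qed
  moreover have "odd (card {m. m < d \<and> k \<in> R m}) \<longleftrightarrow> k = x" for k
  proof -
    consider "k = x" | "k \<in> M" "k \<noteq> x" | "k \<notin> M" "k \<noteq> x" by blast
    then show ?thesis
    proof cases
      case 1
      then have "{m. m < d \<and> k \<in> R m} = {..<d}"
        using M hM by (auto simp: R_def)
      with 1 \<open>odd d\<close> show ?thesis by simp
    next
      case 2
      then obtain l where l: "l < d" "k = h l"
        using h by (auto simp: bij_betw_def)
      have "{m. m < d \<and> k \<in> R m} = {..<d} - {l}"
        using 2 l hinj by (auto simp: R_def)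
      with 2 l \<open>odd d\<close> show ?thesis by simp
    next
      case 3
      then show ?thesis by (simp add: R_def)
    qed
  qed
  ultimately show ?thesis by blast
qed

text \<open>
  The hypotheses are stable under lowering \<open>d\<close> by one and removing a point of \<open>S\<close> from both \<open>S\<close>
  and \<open>I\<close>, as long as \<open>d\<close> stays positive and \<open>S\<close> nonempty; this is the induction step.
\<close>

lemma orthonormal_sets_with_given_sum:
  fixes I S :: "'a set"
  assumes "finite I" "S \<subseteq> I" "S \<noteq> {}" "d \<ge> 1" "d < card I" "even (card S + d)"
  shows "\<exists>R. (\<forall>m<d. R m \<subseteq> I) \<and>
    (\<forall>m<d. \<forall>n<d. odd (card (R m \<inter> R n)) \<longleftrightarrow> m = n) \<and>
    (\<forall>k\<in>I. odd (card {m. m < d \<and> k \<in> R m}) \<longleftrightarrow> k \<in> S)"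
  using assms(4) assms(1-3,5-)
proof (induction d arbitrary: I S rule: nat_induct_at_least)
  case base
  have "{m. m < (1::nat) \<and> k \<in> S} = (if k \<in> S then {0} else {})" for k and S :: "'a set"
    by auto
  with base show ?case
    by (intro exI[of _ "\<lambda>_. S"]) auto
next
  case (Suc d)
  then obtain x where x: "x \<in> S" by blast
  show ?case
  proof (cases "S = {x}")
    case True
    then have "odd (Suc d)" using Suc.prems(5) by simp
    from orthonormal_sets_with_sum_singleton[OF Suc.prems(1) _ this Suc.prems(4), of x]
    show ?thesis using True Suc.prems(2) by simp
  next
    case False
    have S: "finite S" using Suc.prems finite_subset by blast
    let ?I = "I - {x}" and ?S = "S - {x}"
    have "card S = Suc (card ?S)" "card I = Suc (card ?I)"
      using x S Suc.prems by (auto simp: card_Suc_Diff1 subset_iff simp del: card_Diff_insert)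
    then have "\<exists>R. (\<forall>m<d. R m \<subseteq> ?I) \<and>
        (\<forall>m<d. \<forall>n<d. odd (card (R m \<inter> R n)) \<longleftrightarrow> m = n) \<and>
        (\<forall>k\<in>?I. odd (card {m. m < d \<and> k \<in> R m}) \<longleftrightarrow> k \<in> ?S)"
      using x False Suc.prems by (intro Suc.IH) auto
    then obtain R where R: "\<And>m. m < d \<Longrightarrow> R m \<subseteq> ?I"
      "\<And>m n. m < d \<Longrightarrow> n < d \<Longrightarrow> odd (card (R m \<inter> R n)) \<longleftrightarrow> m = n"
      "\<And>k. k \<in> ?I \<Longrightarrow> odd (card {m. m < d \<and> k \<in> R m}) \<longleftrightarrow> k \<in> ?S"
      by blast
    define R' where "R' = R(d := {x})"
    have x_notin: "x \<notin> R m" if "m < d" for m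
      using R(1)[OF that] by blast
    have "R' m \<subseteq> I" if "m < Suc d" for m
      using R(1)[of m] that x Suc.prems by (auto simp: R'_def less_Suc_eq)
    moreover have "odd (card (R' m \<inter> R' n)) \<longleftrightarrow> m = n" if "m < Suc d" "n < Suc d" for m n
      using R(2)[of m n] that x_notin by (auto simp: R'_def less_Suc_eq)
    moreover have "odd (card {m. m < Suc d \<and> k \<in> R' m}) \<longleftrightarrow> k \<in> S" if "k \<in> I" for k
    proof (cases "k = x")
      case True
      then have "{m. m < Suc d \<and> k \<in> R' m} = {d}"
        using x_notin by (auto simp: R'_def less_Suc_eq)
      with True x show ?thesis by simp
    next
      case False
      then have "{m. m < Suc d \<and> k \<in> R' m} = {m. m < d \<and> k \<in> R m}"
        by (auto simp: R'_def less_Suc_eq)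
      with False R(3)[of k] that show ?thesis by simp
    qed
    ultimately show ?thesis by blast
  qed
qed

theorem theorem3p5:
  fixes d K :: nat and \<alpha> :: "bit vec"
  assumes "d \<ge> 1" and "K > d"
    and "\<alpha> \<in> carrier_vec K" and "\<alpha> \<noteq> 0\<^sub>v K"
  shows "(\<exists>f. parseval_frame d K f \<and> (\<forall>i<K. f i \<bullet> f i = \<alpha> $ i))
         \<longleftrightarrow> [norm0 \<alpha> = d] (mod 2)"
proof -
  define S where "S = {k. k < K \<and> \<alpha> $ k = 1}"
  have norm0: "norm0 \<alpha> = card S"
    using assms(3) by (auto simp: norm0_def S_def)
  have alpha: "\<alpha> $ k = of_bool (k \<in> S)" if "k < K" for k
    using that by (auto simp: S_def)
  have parity: "[norm0 \<alpha> = d] (mod 2) \<longleftrightarrow> even (card S + d)"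
    by (simp add: norm0 cong_def mod_2_eq_odd)
  show ?thesis
  proof
    assume "\<exists>f. parseval_frame d K f \<and> (\<forall>i<K. f i \<bullet> f i = \<alpha> $ i)"
    then obtain f where f: "parseval_frame d K f" "\<forall>i<K. f i \<bullet> f i = \<alpha> $ i" by blast
    have "(of_nat d :: bit) = (\<Sum>k<K. of_bool (k \<in> S))"
      using parseval_frame_norms_sum[OF f(1)] f(2) alpha by simp
    also have "\<dots> = of_bool (odd (card {k \<in> {..<K}. k \<in> S}))"
      by (rule sum_of_bool_bit) simp
    also have "{k \<in> {..<K}. k \<in> S} = S"
      by (auto simp: S_def)
    finally show "[norm0 \<alpha> = d] (mod 2)"
      unfolding parity by (auto simp: of_nat_bit_eq_parity split: if_splits)
  next
    assume "[norm0 \<alpha> = d] (mod 2)"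
    moreover have "S \<noteq> {}"
      using assms(3,4) alpha by (auto intro!: eq_vecI)
    moreover have "S \<subseteq> {..<K}" by (auto simp: S_def)
    ultimately have "\<exists>R. (\<forall>m<d. R m \<subseteq> {..<K}) \<and>
        (\<forall>m<d. \<forall>n<d. odd (card (R m \<inter> R n)) \<longleftrightarrow> m = n) \<and>
        (\<forall>k\<in>{..<K}. odd (card {m. m < d \<and> k \<in> R m}) \<longleftrightarrow> k \<in> S)"
      using assms(1,2) unfolding parity by (intro orthonormal_sets_with_given_sum) auto
    then obtain R where R: "\<And>m. m < d \<Longrightarrow> R m \<subseteq> {..<K}"
      "\<And>m n. m < d \<Longrightarrow> n < d \<Longrightarrow> odd (card (R m \<inter> R n)) \<longleftrightarrow> m = n"
      "\<And>k. k < K \<Longrightarrow> odd (card {m. m < d \<and> k \<in> R m}) \<longleftrightarrow> k \<in> S"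
      unfolding Ball_def lessThan_iff by blast
    define f :: "nat \<Rightarrow> bit vec" where "f = (\<lambda>k. vec d (\<lambda>m. of_bool (k \<in> R m)))"
    have "(\<Sum>k<K. f k $ m * f k $ n) = of_bool (m = n)" if mn: "m < d" "n < d" for m n
    proof -
      have "(\<Sum>k<K. f k $ m * f k $ n) = (\<Sum>k<K. of_bool (k \<in> R m \<inter> R n))"
        using mn by (intro sum.cong) (auto simp: f_def)
      also have "\<dots> = of_bool (odd (card {k \<in> {..<K}. k \<in> R m \<inter> R n}))"
        by (rule sum_of_bool_bit) simp
      also have "{k \<in> {..<K}. k \<in> R m \<inter> R n} = R m \<inter> R n"
        using R(1)[OF mn(1)] by auto
      finally show ?thesis using R(2)[OF mn] by simp
    qed
    then have "parseval_frame d K f"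
      unfolding parseval_frame_iff_orthonormal_rows by (simp add: f_def)
    moreover have "f k \<bullet> f k = \<alpha> $ k" if k: "k < K" for k
    proof -
      have "f k \<bullet> f k = (\<Sum>m<d. of_bool (k \<in> R m))"
        by (auto simp: scalar_prod_def f_def lessThan_atLeast0 intro!: sum.cong)
      also have "\<dots> = of_bool (odd (card {m \<in> {..<d}. k \<in> R m}))"
        by (rule sum_of_bool_bit) simp
      finally show ?thesis using R(3)[OF k] alpha[OF k] by simp
    qed
    ultimately show "\<exists>f. parseval_frame d K f \<and> (\<forall>i<K. f i \<bullet> f i = \<alpha> $ i)" by blast
  qed
qed

end
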